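(* Let $G$ be a finite group, $S\subseteq G$ a nonempty symmetric generating set, and $\sigma$ an irreducible representation of $G$. Then $\omega(\sigma)=0$ if and only if $\sigma$ is the trivial representation. Moreover, $\max_{\sigma\in\widehat{G}}\omega(\sigma)=2$ if and only if the Cayley graph associated to $(G,S)$ is bipartite, in which case the unique maximizer is the associated sign character.
   Context: A subset $S$ is symmetric if $s^{-1}\in S$ for all $s\in S$. $\widehat{G}$ is the set of equivalence classes of irreducible complex representations of $G$; each class is represented by a unitary matrix representation $\sigma:G\to U(d_\sigma)$. Put $M_\sigma:=\frac{1}{|S|}\sum_{s\in S}\sigma(s)$; the ordering parameter of $\sigma$ is $\omega(\sigma):=1-\frac{1}{d_\sigma}\operatorname{Tr}[M_\sigma]$ (it depends only on the equivalence class of $\sigma$). The Cayley graph of $(G,S)$ has vertex set $G$ and an edge between $g$ and $gs$ for every $g\in G$, $s\in S$ (a loop at every vertex if the identity lies in $S$, in which case the graph is not bipartite). Since $S$ generates $G$ the graph is connected; when it is bipartite, the associated sign character is the function $G\to\{\pm1\}$ equal to $+1$ on the part of the bipartition containing the identity and $-1$ on the other part. *)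

theory Defs
  imports "HOL-Algebra.Generated_Groups" "Jordan_Normal_Form.VS_Connect"
    "Graph_Theory.Pair_Digraph"
begin

definition mat_trace :: "complex mat \<Rightarrow> complex" where
  "mat_trace A = (\<Sum>i<dim_row A. A $$ (i, i))"

abbreviation GL :: "nat \<Rightarrow> complex mat monoid" where
  "GL d \<equiv> units_of (ring_mat TYPE(complex) d ())"

text \<open>A matrix representation is a function into complex matrices; its degree is the size of
  its values on the carrier and is read off at the identity.\<close>

definition rep_dim :: "('g, 'm) monoid_scheme \<Rightarrow> ('g \<Rightarrow> complex mat) \<Rightarrow> nat" where
  "rep_dim G \<sigma> = dim_row (\<sigma> \<one>\<^bsub>G\<^esub>)"

definition matrix_rep :: "('g, 'm) monoid_scheme \<Rightarrow> ('g \<Rightarrow> complex mat) \<Rightarrow> bool" where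
  "matrix_rep G \<sigma> \<longleftrightarrow> \<sigma> \<in> hom G (GL (rep_dim G \<sigma>))"

definition irreducible_rep :: "('g, 'm) monoid_scheme \<Rightarrow> ('g \<Rightarrow> complex mat) \<Rightarrow> bool" where
  "irreducible_rep G \<sigma> \<longleftrightarrow>
     matrix_rep G \<sigma> \<and> rep_dim G \<sigma> > 0 \<and>
     (\<forall>W. VectorSpace.subspace class_ring W (module_vec TYPE(complex) (rep_dim G \<sigma>)) \<and>
          (\<forall>g\<in>carrier G. \<forall>w\<in>W. \<sigma> g *\<^sub>v w \<in> W) \<longrightarrow>
          W = {0\<^sub>v (rep_dim G \<sigma>)} \<or> W = carrier_vec (rep_dim G \<sigma>))"

text \<open>Equivalence: one change of basis conjugates all values on the carrier simultaneously.
  In particular, functions that agree on the carrier are identified.\<close>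

definition rep_equiv ::
    "('g, 'm) monoid_scheme \<Rightarrow> (('g \<Rightarrow> complex mat) \<times> ('g \<Rightarrow> complex mat)) set" where
  "rep_equiv G = {(\<sigma>, \<tau>). irreducible_rep G \<sigma> \<and> irreducible_rep G \<tau> \<and>
     (\<exists>P Q. \<forall>g\<in>carrier G. similar_mat_wit (\<sigma> g) (\<tau> g) P Q)}"

definition irr_classes :: "('g, 'm) monoid_scheme \<Rightarrow> ('g \<Rightarrow> complex mat) set set" where
  "irr_classes G = {\<sigma>. irreducible_rep G \<sigma>} // rep_equiv G"

definition avg_mat ::
    "('g, 'm) monoid_scheme \<Rightarrow> 'g set \<Rightarrow> ('g \<Rightarrow> complex mat) \<Rightarrow> complex mat" where
  "avg_mat G S \<sigma> = (1 / of_nat (card S)) \<cdot>\<^sub>m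
     finsum (ring_mat TYPE(complex) (rep_dim G \<sigma>) ()) \<sigma> S"

definition order_param ::
    "('g, 'm) monoid_scheme \<Rightarrow> 'g set \<Rightarrow> ('g \<Rightarrow> complex mat) \<Rightarrow> complex" where
  "order_param G S \<sigma> = 1 - (1 / of_nat (rep_dim G \<sigma>)) * mat_trace (avg_mat G S \<sigma>)"

text \<open>The parameter is constant on equivalence classes, since the trace is invariant under
  similarity; any representative may be used, in particular a unitary one. For a symmetric set
  it is real, so taking the real part below only serves to land in an ordered type.\<close>

definition class_order_param ::
    "('g, 'm) monoid_scheme \<Rightarrow> 'g set \<Rightarrow> ('g \<Rightarrow> complex mat) set \<Rightarrow> real" where
  "class_order_param G S C = Re (the_elem (order_param G S ` C))"

definition trivial_rep :: "'g \<Rightarrow> complex mat" where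
  "trivial_rep = (\<lambda>_. 1\<^sub>m 1)"

definition cayley_graph :: "('g, 'm) monoid_scheme \<Rightarrow> 'g set \<Rightarrow> 'g pair_pre_digraph" where
  "cayley_graph G S =
     \<lparr> pverts = carrier G, parcs = {(g, g \<otimes>\<^bsub>G\<^esub> s) | g s. g \<in> carrier G \<and> s \<in> S} \<rparr>"

definition bipartition :: "'v pair_pre_digraph \<Rightarrow> 'v set \<Rightarrow> 'v set \<Rightarrow> bool" where
  "bipartition H A B \<longleftrightarrow> A \<union> B = pverts H \<and> A \<inter> B = {} \<and>
     (\<forall>(u, v)\<in>parcs H. u \<in> A \<and> v \<in> B \<or> u \<in> B \<and> v \<in> A)"

definition bipartite :: "'v pair_pre_digraph \<Rightarrow> bool" where
  "bipartite H \<longleftrightarrow> (\<exists>A B. bipartition H A B)"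

text \<open>The sign character of a bipartition, where \<open>A\<close> is the part containing the identity,
  as a representation of degree one.\<close>

definition sign_rep :: "'g set \<Rightarrow> 'g \<Rightarrow> complex mat" where
  "sign_rep A g = (if g \<in> A then 1 else - 1) \<cdot>\<^sub>m 1\<^sub>m 1"

end

theory Submission
  imports Defs "HOL-Algebra.Multiplicative_Group" "Jordan_Normal_Form.Schur_Decomposition"
begin

text \<open>The eigenvalues of each \<open>\<sigma>(s)\<close> are roots of unity, so \<open>Re Tr \<sigma>(s)\<close> lies between \<open>-d\<close> and
  \<open>d\<close>, and it attains a bound only if all eigenvalues agree; as a matrix of finite order is
  diagonalizable, then \<open>\<sigma>(s)\<close> is \<open>-1\<close> or \<open>1\<close>. Hence \<open>\<omega>(\<sigma>) = 0\<close> forces \<open>\<sigma> = 1\<close> on \<open>S\<close>, and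
  \<open>\<omega>(\<sigma>) = 2\<close> forces \<open>\<sigma> = -1\<close> on \<open>S\<close>. In both cases every \<open>\<sigma>(g)\<close> is a scalar, so irreducibility
  gives degree one and \<open>\<sigma>\<close> is determined by its values on \<open>S\<close>. A representation equal to \<open>-1\<close> on
  \<open>S\<close> is the same thing as a bipartition of the Cayley graph.\<close>

section \<open>Matrices of finite order\<close>

lemma mat_trace_eq_sum_list_diag: "mat_trace A = sum_list (diag_mat A)"
  by (simp add: mat_trace_def diag_mat_def interv_sum_list_conv_sum_set_nat atLeast0LessThan)

lemma mat_trace_comm:
  assumes "A \<in> carrier_mat n m" "B \<in> carrier_mat m n"
  shows "mat_trace (A * B) = mat_trace (B * A)"
proof -
  have "mat_trace (A * B) = (\<Sum>i<n. \<Sum>j<m. A $$ (i, j) * B $$ (j, i))"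
    using assms by (auto simp: mat_trace_def scalar_prod_def atLeast0LessThan intro!: sum.cong)
  also have "\<dots> = (\<Sum>j<m. \<Sum>i<n. B $$ (j, i) * A $$ (i, j))"
    by (subst sum.swap) (simp add: mult.commute)
  also have "\<dots> = mat_trace (B * A)"
    using assms by (auto simp: mat_trace_def scalar_prod_def atLeast0LessThan intro!: sum.cong)
  finally show ?thesis .
qed

lemma mat_trace_similar:
  assumes "similar_mat_wit A B P Q"
  shows "mat_trace A = mat_trace B"
proof -
  define n where "n = dim_row A"
  note sim = similar_mat_witD[OF n_def assms]
  have "mat_trace A = mat_trace (P * (B * Q))"
    by (subst sim(3)) (simp only: assoc_mult_mat[OF sim(6,5,7)])
  also have "\<dots> = mat_trace (B * Q * P)"
    using sim(5-7) by (intro mat_trace_comm) auto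
  also have "B * Q * P = B"
    using assoc_mult_mat[OF sim(5,7,6)] sim(2,5) by simp
  finally show ?thesis .
qed

section \<open>Triangular form of matrices of finite order\<close>

lemma eigenvalue_of_finite_order:
  fixes A :: "'a :: field mat"
  assumes A: "A \<in> carrier_mat n n" and pow: "A ^\<^sub>m k = 1\<^sub>m n" and ev: "eigenvalue A e"
  shows "e ^ k = 1"
proof -
  obtain v where v: "eigenvector A v e"
    using ev unfolding eigenvalue_def by blast
  have vc: "v \<in> carrier_vec n" "v \<noteq> 0\<^sub>v n"
    using v A unfolding eigenvector_def by auto
  have eq: "v = e ^ k \<cdot>\<^sub>v v"
    using eigenvector_pow[OF A v, of k] pow vc by simp
  obtain i where i: "i < n" "v $ i \<noteq> 0"
    using vc by (metis carrier_vecD eq_vecI index_zero_vec)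
  have "v $ i = e ^ k * v $ i"
    using arg_cong[OF eq, of "\<lambda>w. w $ i"] i vc by simp
  then show ?thesis using i by simp
qed

text \<open>Over the complex numbers the characteristic polynomial splits, so there is a Schur form
  whose diagonal lists its roots; these are eigenvalues, hence roots of unity when
  \<open>k > 0\<close>.\<close>

lemma finite_order_triangularE:
  fixes A :: "complex mat"
  assumes A: "A \<in> carrier_mat n n" and pow: "A ^\<^sub>m k = 1\<^sub>m n"
  obtains B P Q where "similar_mat_wit A B P Q" "upper_triangular B" "B \<in> carrier_mat n n"
    "\<And>i. i < n \<Longrightarrow> (B $$ (i, i)) ^ k = 1"
proof -
  obtain es where es: "char_poly A = (\<Prod>e\<leftarrow>es. [:- e, 1:])" "length es = n"
    using char_poly_factorized[OF A] by blast
  obtain B P Q where schur: "schur_decomposition A es = (B, P, Q)"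
    by (cases "schur_decomposition A es")
  have sim: "similar_mat_wit A B P Q" and ut: "upper_triangular B" and diag: "diag_mat B = es"
    using schur_decomposition[OF A es(1) schur] by auto
  have B: "B \<in> carrier_mat n n"
    using similar_mat_witD2[OF A sim] by auto
  have "(B $$ (i, i)) ^ k = 1" if "i < n" for i
  proof -
    have "B $$ (i, i) \<in> set es"
      using diag that B unfolding diag_mat_def by force
    then have "poly (char_poly A) (B $$ (i, i)) = 0"
      unfolding es(1) by (auto simp: poly_prod_list prod_list_zero_iff)
    then show ?thesis
      using eigenvalue_of_finite_order[OF A pow] eigenvalue_root_char_poly[OF A] by blast
  qed
  with sim ut B that show ?thesis by blast
qed

text \<open>By induction on \<open>j\<close>, column \<open>j\<close> of \<open>B\<close> is \<open>c e\<^sub>j + w\<close> with \<open>w\<close> in the span of the earlier unit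
  vectors, hence \<open>B w = c w\<close> and \<open>B\<^sup>m e\<^sub>j = c\<^sup>m e\<^sub>j + m c\<^sup>m\<^sup>-\<^sup>1 w\<close>; periodicity forces \<open>w = 0\<close>.\<close>

lemma triangular_finite_order_eq_scalar:
  fixes B :: "'a :: field_char_0 mat"
  assumes B: "B \<in> carrier_mat n n" and ut: "upper_triangular B"
    and diag: "\<And>i. i < n \<Longrightarrow> B $$ (i, i) = c" and c: "c \<noteq> 0"
    and pow: "B ^\<^sub>m k = 1\<^sub>m n" and k: "k > 0"
  shows "B = c \<cdot>\<^sub>m 1\<^sub>m n"
proof -
  have col: "\<forall>i<n. B $$ (i, j) = (if i = j then c else 0)" if "j < n" for j
    using that
  proof (induction j rule: less_induct)
    case (less j)
    define w where "w = vec n (\<lambda>i. if i = j then 0 else B $$ (i, j))"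
    have w: "w \<in> carrier_vec n" by (simp add: w_def)
    have w0: "w $ i = 0" if "i < n" "\<not> i < j" for i
      using that ut B by (auto simp: w_def)
    have Bw: "B *\<^sub>v w = c \<cdot>\<^sub>v w"
    proof (rule eq_vecI)
      fix i assume "i < dim_vec (c \<cdot>\<^sub>v w)"
      then have i: "i < n" using w by simp
      have "(B *\<^sub>v w) $ i = (\<Sum>l<n. B $$ (i, l) * w $ l)"
        using i B w by (simp add: scalar_prod_def atLeast0LessThan)
      \<comment> \<open>For \<open>l < j\<close> the induction hypothesis makes column
        \<open>l\<close> of \<open>B\<close> equal to \<open>c\<close> times a unit vector; for all
        other \<open>l\<close> the entry \<open>w $ l\<close> is zero.\<close>
      also have "\<dots> = (\<Sum>l<n. if l = i then c * w $ i else 0)"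
      proof (rule sum.cong[OF refl])
        fix l assume l: "l \<in> {..<n}"
        show "B $$ (i, l) * w $ l = (if l = i then c * w $ i else 0)"
        proof (cases "l < j")
          case True
          then show ?thesis using less.IH[OF True] l i by auto
        next
          case False
          then show ?thesis using w0[of l] l by auto
        qed
      qed
      also have "\<dots> = c * w $ i" using i by simp
      finally show "(B *\<^sub>v w) $ i = (c \<cdot>\<^sub>v w) $ i" using i w by simp
    qed (use B w in auto)
    have Be: "B *\<^sub>v unit_vec n j = c \<cdot>\<^sub>v unit_vec n j + w"
      using B less.prems diag[of j] by (intro eq_vecI) (auto simp: w_def)
    \<comment> \<open>At \<open>m = 0\<close> the truncated exponent \<open>m - 1\<close> is
      harmless, as the factor \<open>of_nat m\<close> vanishes.\<close>
    have pow_e: "B ^\<^sub>m m *\<^sub>v unit_vec n j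
        = c ^ m \<cdot>\<^sub>v unit_vec n j + (of_nat m * c ^ (m - 1)) \<cdot>\<^sub>v w" for m
    proof (induction m)
      case 0
      then show ?case using B w by (auto intro!: eq_vecI)
    next
      case (Suc m)
      have ev: "B ^\<^sub>m m *\<^sub>v w = c ^ m \<cdot>\<^sub>v w"
      proof (induction m)
        case 0
        then show ?case using B w by simp
      next
        case (Suc m)
        have "B ^\<^sub>m Suc m *\<^sub>v w = B ^\<^sub>m m *\<^sub>v (B *\<^sub>v w)"
          using B w by (simp add: assoc_mult_mat_vec[of _ n n _ n])
        also have "\<dots> = c \<cdot>\<^sub>v (B ^\<^sub>m m *\<^sub>v w)"
          unfolding Bw using B w by (intro mult_mat_vec) auto
        finally show ?case using Suc w by (simp add: smult_smult_assoc)
      qed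
      have "B ^\<^sub>m Suc m *\<^sub>v unit_vec n j = B ^\<^sub>m m *\<^sub>v (B *\<^sub>v unit_vec n j)"
        using B by (simp add: assoc_mult_mat_vec[of _ n n _ n])
      also have "\<dots> = c \<cdot>\<^sub>v (B ^\<^sub>m m *\<^sub>v unit_vec n j) + B ^\<^sub>m m *\<^sub>v w"
        unfolding Be using B w
        by (subst mult_add_distrib_mat_vec[of _ n n]) (auto simp: mult_mat_vec[of _ n n])
      also have "\<dots> = c ^ Suc m \<cdot>\<^sub>v unit_vec n j + (of_nat (Suc m) * c ^ (Suc m - 1)) \<cdot>\<^sub>v w"
        unfolding Suc ev using w
        by (intro eq_vecI) (auto simp: algebra_simps power_eq_if)
      finally show ?case .
    qed
    have wz: "w $ i = 0" if i: "i < n" for i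
    proof (cases "i < j")
      case True
      \<comment> \<open>Since \<open>B ^\<^sub>m k\<close> is the identity, entry \<open>i\<close>
        reads \<open>0 = of_nat k * c ^ (k - 1) * w $ i\<close>; in characteristic zero the factor
        before \<open>w $ i\<close> is nonzero.\<close>
      have "(unit_vec n j :: 'a vec) $ i
          = (c ^ k \<cdot>\<^sub>v unit_vec n j + (of_nat k * c ^ (k - 1)) \<cdot>\<^sub>v w) $ i"
        using pow_e[of k] pow by simp
      then show ?thesis using i True w c k less.prems by simp
    qed (use w0 i in auto)
    have "B $$ (i, j) = 0" if "i < n" "i \<noteq> j" for i
      using wz[OF that(1)] that by (simp add: w_def)
    then show ?case using diag less.prems by simp
  qed
  show ?thesis
    using B col by (intro eq_matI) auto
qed

section \<open>Extremal traces\<close>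

lemma Re_mult_cnj_eq_one_imp_eq:
  assumes "norm z = 1" "norm w = 1" "Re (cnj w * z) = 1"
  shows "z = w"
proof -
  have "norm (cnj w * z) = 1" using assms by (simp add: norm_mult)
  \<comment> \<open>Modulus one and real part one leave no room for an imaginary part.\<close>
  then have "Im (cnj w * z) = 0"
    using assms(3) cmod_power2[of "cnj w * z"] by simp
  then have "cnj w * z = 1" using assms(3) by (simp add: complex_eq_iff)
  then have "w * (cnj w * z) = w" by simp
  moreover have "w * cnj w = 1" using assms(2) by (simp add: complex_norm_square[symmetric])
  ultimately show ?thesis by (metis mult.assoc mult_1)
qed

text \<open>Rotating by \<open>cnj c\<close> lets \<open>c = 1\<close> and \<open>c = -1\<close>
  share one argument. Each rotated diagonal entry of the triangular form has real part at most one;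
  in the equality case all entries are \<open>c\<close>, and finite order then makes the form
  scalar.\<close>

lemma
  fixes A :: "complex mat"
  assumes A: "A \<in> carrier_mat n n" and pow: "A ^\<^sub>m k = 1\<^sub>m n" and k: "k > 0"
    and c: "norm c = 1"
  shows finite_order_trace_le: "Re (cnj c * mat_trace A) \<le> n"
    and finite_order_trace_eq_imp_scalar: "Re (cnj c * mat_trace A) = n \<Longrightarrow> A = c \<cdot>\<^sub>m 1\<^sub>m n"
proof -
  obtain B P Q where sim: "similar_mat_wit A B P Q" and ut: "upper_triangular B"
    and B: "B \<in> carrier_mat n n" and root: "\<And>i. i < n \<Longrightarrow> (B $$ (i, i)) ^ k = 1"
    using finite_order_triangularE[OF A pow] by blast
  have norm1: "norm (B $$ (i, i)) = 1" if "i < n" for i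
    using root[OF that] k by (metis norm_one norm_power power_eq_1_iff norm_ge_zero
        less_numeral_extra(3))
  have tr: "Re (cnj c * mat_trace A) = (\<Sum>i<n. Re (cnj c * B $$ (i, i)))"
    unfolding mat_trace_similar[OF sim] using B by (simp add: mat_trace_def sum_distrib_left)
  have le1: "Re (cnj c * B $$ (i, i)) \<le> 1" if "i < n" for i
    using complex_Re_le_cmod[of "cnj c * B $$ (i, i)"] norm1[OF that] c by (simp add: norm_mult)
  show "Re (cnj c * mat_trace A) \<le> n"
    unfolding tr using sum_mono[of "{..<n}" "\<lambda>i. Re (cnj c * B $$ (i, i))" "\<lambda>_. 1"] le1 by simp
  assume eq: "Re (cnj c * mat_trace A) = n"
  have diag: "B $$ (i, i) = c" if "i < n" for i
  proof (rule Re_mult_cnj_eq_one_imp_eq[OF norm1[OF that] c])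
    have "(\<Sum>i<n. 1 - Re (cnj c * B $$ (i, i))) = 0"
      using eq tr by (simp add: sum_subtractf)
    then have "1 - Re (cnj c * B $$ (i, i)) = 0"
      using le1 that by (subst (asm) sum_nonneg_eq_0_iff) auto
    then show "Re (cnj c * B $$ (i, i)) = 1" by simp
  qed
  note sims = similar_mat_witD2[OF A sim]
  \<comment> \<open>Conjugation carries the finite order over to the triangular form, as the scalar
    criterion requires.\<close>
  have "B ^\<^sub>m k = 1\<^sub>m n"
  proof -
    have "similar_mat_wit (B ^\<^sub>m k) (1\<^sub>m n) Q P"
      using similar_mat_wit_pow[OF similar_mat_wit_sym[OF sim], of k] pow by simp
    then have "B ^\<^sub>m k = Q * 1\<^sub>m n * P" by (rule similar_mat_witD(3)[OF refl])
    then show ?thesis using sims by simp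
  qed
  then have "B = c \<cdot>\<^sub>m 1\<^sub>m n"
    using triangular_finite_order_eq_scalar[OF B ut diag _ _ k] c by force
  then have "A = P * (c \<cdot>\<^sub>m 1\<^sub>m n) * Q" using sims(3) by simp
  also have "P * (c \<cdot>\<^sub>m 1\<^sub>m n) = c \<cdot>\<^sub>m P"
    using mult_smult_distrib[OF sims(6) one_carrier_mat] sims(6) by simp
  also have "c \<cdot>\<^sub>m P * Q = c \<cdot>\<^sub>m (P * Q)"
    by (rule mult_smult_assoc_mat[OF sims(6,7)])
  finally show "A = c \<cdot>\<^sub>m 1\<^sub>m n" using sims by simp
qed

text \<open>For fixed \<open>n\<close> and \<open>k > 0\<close> this confines the trace to a finite
  set, which later makes the set of parameters finite.\<close>

lemma finite_order_trace_in_sum_list_roots: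
  fixes A :: "complex mat"
  assumes A: "A \<in> carrier_mat n n" and pow: "A ^\<^sub>m k = 1\<^sub>m n"
  shows "mat_trace A \<in> sum_list ` {es. set es \<subseteq> {z. z ^ k = 1} \<and> length es = n}"
proof -
  obtain B P Q where sim: "similar_mat_wit A B P Q" and "upper_triangular B"
    and B: "B \<in> carrier_mat n n"
    and root: "\<And>i. i < n \<Longrightarrow> (B $$ (i, i)) ^ k = 1"
    using finite_order_triangularE[OF A pow] by blast
  have "set (diag_mat B) \<subseteq> {z. z ^ k = 1}" "length (diag_mat B) = n"
    using B root by (auto simp: diag_mat_def)
  then show ?thesis
    by (simp add: mat_trace_similar[OF sim] mat_trace_eq_sum_list_diag[of B])
qed

section \<open>Matrix representations\<close>

lemma subspace_module_vec_iff:
  "VectorSpace.subspace class_ring W (module_vec TYPE('a :: field) n) \<longleftrightarrow>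
     W \<subseteq> carrier_vec n \<and> 0\<^sub>v n \<in> W \<and> (\<forall>v\<in>W. \<forall>w\<in>W. v + w \<in> W) \<and> (\<forall>c. \<forall>v\<in>W. c \<cdot>\<^sub>v v \<in> W)"
  using vec_vs[where 'a = 'a, of n] vec_module[where 'a = 'a, of n]
  by (auto simp: VectorSpace.subspace_def submodule_def module_vec_simps)

text \<open>A nonzero vector has a nonzero entry at index 0, and rescaling it reaches every vector.
  This is why representations of degree one are irreducible.\<close>

lemma subspace_module_vec_one:
  fixes W :: "'a :: field vec set"
  assumes "VectorSpace.subspace class_ring W (module_vec TYPE('a) 1)"
  shows "W = {0\<^sub>v 1} \<or> W = carrier_vec 1"
proof (cases "W \<subseteq> {0\<^sub>v 1}")
  case True
  then show ?thesis using assms by (auto simp: subspace_module_vec_iff)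
next
  case False
  then obtain w where w: "w \<in> W" "w \<noteq> 0\<^sub>v 1" by blast
  have W: "W \<subseteq> carrier_vec 1" using assms by (simp add: subspace_module_vec_iff)
  then have wc: "w \<in> carrier_vec 1" using w by blast
  then have w0: "w $ 0 \<noteq> 0" using w(2) by (auto intro: eq_vecI)
  have "v \<in> W" if "v \<in> carrier_vec 1" for v
  proof -
    have "v = (v $ 0 / w $ 0) \<cdot>\<^sub>v w"
      using that wc w0 by (intro eq_vecI) auto
    then show ?thesis using assms w(1) by (metis subspace_module_vec_iff)
  qed
  then show ?thesis using W by blast
qed

section \<open>Linearity of the trace\<close>

lemma mat_trace_smult: "mat_trace (c \<cdot>\<^sub>m A) = c * mat_trace A" if "A \<in> carrier_mat n n"
  using that by (simp add: mat_trace_def sum_distrib_left)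

lemma mat_trace_add:
  assumes "A \<in> carrier_mat n n" "B \<in> carrier_mat n n"
  shows "mat_trace (A + B) = mat_trace A + mat_trace B"
  using assms by (simp add: mat_trace_def sum.distrib)

lemma mat_trace_one: "mat_trace (1\<^sub>m n) = of_nat n"
  by (simp add: mat_trace_def)

text \<open>Membership in the carrier is proved along with the trace formula, because splitting off
  a summand needs the partial sum to have the right size.\<close>

lemma mat_trace_finsum:
  assumes "finite S" "\<And>s. s \<in> S \<Longrightarrow> f s \<in> carrier_mat n n"
  shows "finsum (ring_mat TYPE(complex) n ()) f S \<in> carrier_mat n n \<and>
    mat_trace (finsum (ring_mat TYPE(complex) n ()) f S) = (\<Sum>s\<in>S. mat_trace (f s))"
  using assms
proof (induction S rule: finite_induct)
  case empty
  interpret R: ring "ring_mat TYPE(complex) n ()" by (rule ring_mat)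
  show ?case by (simp add: ring_mat_simps mat_trace_def)
next
  case (insert x S)
  interpret R: ring "ring_mat TYPE(complex) n ()" by (rule ring_mat)
  have "finsum (ring_mat TYPE(complex) n ()) f (insert x S)
      = f x + finsum (ring_mat TYPE(complex) n ()) f S"
    using insert R.finsum_insert[of S x f] by (auto simp: ring_mat_simps)
  then show ?case
    using insert by (auto simp: mat_trace_add[of _ n])
qed

section \<open>Representations as homomorphisms\<close>

lemma matrix_rep_carrier:
  assumes "matrix_rep G \<sigma>" "g \<in> carrier G"
  shows "\<sigma> g \<in> carrier_mat (rep_dim G \<sigma>) (rep_dim G \<sigma>)"
  using assms by (auto simp: matrix_rep_def hom_def units_of_def Units_def ring_mat_simps)

lemma matrix_rep_mult:
  assumes "matrix_rep G \<sigma>" "g \<in> carrier G" "h \<in> carrier G"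
  shows "\<sigma> (g \<otimes>\<^bsub>G\<^esub> h) = \<sigma> g * \<sigma> h"
  using assms by (auto simp: matrix_rep_def hom_def units_of_def ring_mat_simps)

lemma irreducible_repD:
  assumes "irreducible_rep G \<sigma>"
  shows "matrix_rep G \<sigma>" "rep_dim G \<sigma> > 0"
  using assms by (auto simp: irreducible_rep_def)

lemma irreducible_rep_invariant_subspace:
  assumes "irreducible_rep G \<sigma>" "rep_dim G \<sigma> = d"
    and "VectorSpace.subspace class_ring W (module_vec TYPE(complex) d)"
    and "\<And>g w. g \<in> carrier G \<Longrightarrow> w \<in> W \<Longrightarrow> \<sigma> g *\<^sub>v w \<in> W"
    and "w \<in> W" "w \<noteq> 0\<^sub>v d"
  shows "W = carrier_vec d"
  using assms unfolding irreducible_rep_def by blast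

context group
begin

lemma matrix_rep_one:
  assumes "matrix_rep G \<sigma>"
  shows "\<sigma> \<one> = 1\<^sub>m (rep_dim G \<sigma>)"
proof -
  interpret R: ring "ring_mat TYPE(complex) (rep_dim G \<sigma>) ()" by (rule ring_mat)
  have "\<sigma> \<one> = \<one>\<^bsub>GL (rep_dim G \<sigma>)\<^esub>"
    using assms is_group R.units_group unfolding matrix_rep_def by (rule hom_one)
  then show ?thesis by (simp add: units_of_def ring_mat_simps)
qed

lemma matrix_rep_pow:
  assumes "matrix_rep G \<sigma>" "g \<in> carrier G"
  shows "\<sigma> (g [^] (k :: nat)) = \<sigma> g ^\<^sub>m k"
proof (induction k)
  case 0
  then show ?case using matrix_rep_one matrix_rep_carrier assms by fastforce
next
  case (Suc k)
  then show ?case using assms by (simp add: matrix_rep_mult)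
qed

text \<open>By Lagrange, the group order is an exponent common to all elements.\<close>

lemma matrix_rep_pow_order:
  assumes "matrix_rep G \<sigma>" "g \<in> carrier G"
  shows "\<sigma> g ^\<^sub>m Coset.order G = 1\<^sub>m (rep_dim G \<sigma>)"
  using assms matrix_rep_pow[OF assms, of "Coset.order G"] by (simp add: pow_order_eq_1 matrix_rep_one)

text \<open>Scalar matrices preserve every subspace, so irreducibility forces a line to be the whole
  space.\<close>

lemma irreducible_rep_scalar_imp_dim_one:
  assumes irr: "irreducible_rep G \<sigma>"
    and scalar: "\<And>g. g \<in> carrier G \<Longrightarrow> \<exists>c. \<sigma> g = c \<cdot>\<^sub>m 1\<^sub>m (rep_dim G \<sigma>)"
  shows "rep_dim G \<sigma> = 1"
proof -
  define d where "d = rep_dim G \<sigma>"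
  have d: "d > 0" using irreducible_repD(2)[OF irr] by (simp add: d_def)
  \<comment> \<open>This is the line spanned by the first unit vector, given by coordinates.\<close>
  define W :: "complex vec set" where "W = {v \<in> carrier_vec d. \<forall>i<d. i \<noteq> 0 \<longrightarrow> v $ i = 0}"
  have "W = carrier_vec d"
  proof (rule irreducible_rep_invariant_subspace[OF irr d_def[symmetric], where w = "unit_vec d 0"])
    show sub: "VectorSpace.subspace class_ring W (module_vec TYPE(complex) d)"
      unfolding subspace_module_vec_iff
    proof (intro conjI ballI allI)
      show "W \<subseteq> carrier_vec d" "0\<^sub>v d \<in> W" by (auto simp: W_def)
    next
      fix v w assume "v \<in> W" "w \<in> W"
      then have "v \<in> carrier_vec d" "w \<in> carrier_vec d"
        "v $ i = 0" "w $ i = 0" if "i < d" "i \<noteq> 0" for i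
        using that unfolding W_def by blast+
      then show "v + w \<in> W"
        using \<open>v \<in> W\<close> \<open>w \<in> W\<close> by (auto simp: W_def)
    next
      fix v c assume "v \<in> W"
      then show "c \<cdot>\<^sub>v v \<in> W" by (auto simp: W_def)
    qed
    fix g w assume g: "g \<in> carrier G" and w: "w \<in> W"
    obtain c where c: "\<sigma> g = c \<cdot>\<^sub>m 1\<^sub>m d" using scalar[OF g] unfolding d_def by blast
    have "w \<in> carrier_vec d" using w by (simp add: W_def)
    then have "\<sigma> g *\<^sub>v w = c \<cdot>\<^sub>v w"
      unfolding c by (intro eq_vecI) auto
    then show "\<sigma> g *\<^sub>v w \<in> W" using sub w by (simp add: subspace_module_vec_iff)
  next
    show "(unit_vec d 0 :: complex vec) \<in> W" by (simp add: W_def)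
    show "unit_vec d 0 \<noteq> (0\<^sub>v d :: complex vec)"
      using d by (metis index_unit_vec(1) index_zero_vec(1) zero_neq_one)
  qed
  \<comment> \<open>For \<open>1 < d\<close> the entry at index 1 contradicts the definition of
    \<open>W\<close>; for \<open>d = 1\<close> this vector is zero.\<close>
  then have "(unit_vec d 1 :: complex vec) \<in> W" by simp
  then have "\<not> 1 < d" by (auto simp: W_def)
  then show ?thesis using d by (simp add: d_def)
qed

text \<open>The orbit of a nonzero vector spans an invariant subspace.\<close>

lemma irreducible_rep_dim_le_order:
  assumes irr: "irreducible_rep G \<sigma>" and finG: "finite (carrier G)"
  shows "rep_dim G \<sigma> \<le> Coset.order G"
proof -
  define d where "d = rep_dim G \<sigma>"
  note rep = irreducible_repD(1)[OF irr]
  have d: "d > 0" using irreducible_repD(2)[OF irr] by (simp add: d_def)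
  interpret vec_space "TYPE(complex)" d .
  define v :: "complex vec" where "v = unit_vec d 0"
  define X where "X = (\<lambda>g. \<sigma> g *\<^sub>v v) ` carrier G"
  have v: "v \<in> carrier_vec d" by (simp add: v_def)
  have mat: "\<sigma> g \<in> carrier_mat d d" if "g \<in> carrier G" for g
    using matrix_rep_carrier[OF rep that] by (simp add: d_def)
  have X: "X \<subseteq> carrier_vec d" using mult_mat_vec_carrier[OF mat v] by (auto simp: X_def)
  have sub: "VectorSpace.subspace class_ring (span X) (module_vec TYPE(complex) d)"
    using span_is_subspace X by simp
  note subD = sub[unfolded subspace_module_vec_iff]
  have "span X = carrier_vec d"
  proof (rule irreducible_rep_invariant_subspace[OF irr d_def[symmetric], where w = v])
    show "VectorSpace.subspace class_ring (span X) (module_vec TYPE(complex) d)"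
      by (rule sub)
    fix g w assume g: "g \<in> carrier G" and w: "w \<in> span X"
    \<comment> \<open>The preimage of the span under \<open>\<sigma> g\<close> is a subspace; since
      it contains the orbit, it contains the span.\<close>
    let ?N = "{w \<in> carrier_vec d. \<sigma> g *\<^sub>v w \<in> span X}"
    have "\<sigma> g *\<^sub>v 0\<^sub>v d = 0\<^sub>v d" using mat[OF g] by (intro eq_vecI) auto
    then have "VectorSpace.subspace class_ring ?N (module_vec TYPE(complex) d)"
      unfolding subspace_module_vec_iff
      using subD mat[OF g] by (auto simp: mult_add_distrib_mat_vec[of _ d d] mult_mat_vec[of _ d d])
    moreover have "X \<subseteq> ?N"
    proof
      fix x assume x: "x \<in> X"
      then obtain h where h: "h \<in> carrier G" "x = \<sigma> h *\<^sub>v v" by (auto simp: X_def)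
      have "\<sigma> g *\<^sub>v x = \<sigma> (g \<otimes> h) *\<^sub>v v"
        using h g assoc_mult_mat_vec[OF mat mat v] by (simp add: matrix_rep_mult[OF rep])
      then have "\<sigma> g *\<^sub>v x \<in> X" using h g by (auto simp: X_def)
      then show "x \<in> ?N" using x X in_own_span[OF X] by auto
    qed
    ultimately have "span X \<subseteq> ?N"
      by (intro span_is_subset) (auto simp: VectorSpace.subspace_def)
    then show "\<sigma> g *\<^sub>v w \<in> span X" using w by blast
  next
    have "v = \<sigma> \<one> *\<^sub>v v" using matrix_rep_one[OF rep] v by (simp add: d_def)
    then have "v \<in> X" unfolding X_def by (metis one_closed image_eqI)
    then show "v \<in> span X" using in_own_span[OF X] by blast
    show "v \<noteq> 0\<^sub>v d"
      using d unfolding v_def by (metis index_unit_vec(1) index_zero_vec(1) zero_neq_one)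
  qed
  then have "dim \<le> card X"
    using finG X by (intro gen_ge_dim) (auto simp: X_def)
  also have "card X \<le> Coset.order G"
    using finG by (simp add: X_def Coset.order_def card_image_le)
  finally have "d \<le> Coset.order G" unfolding dim_is_n .
  then show ?thesis by (simp add: d_def)
qed

text \<open>The hypothesis makes the sign attached to \<open>A\<close> multiplicative. The values
  square to one, hence are units, and degree one leaves no proper nonzero subspace.\<close>

lemma sign_rep_irreducible:
  assumes A: "\<And>g h. g \<in> carrier G \<Longrightarrow> h \<in> carrier G \<Longrightarrow> g \<otimes> h \<in> A \<longleftrightarrow> (g \<in> A \<longleftrightarrow> h \<in> A)"
  shows "irreducible_rep G (sign_rep A)"
proof -
  have dim: "rep_dim G (sign_rep A) = 1" by (simp add: rep_dim_def sign_rep_def)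
  have sq: "sign_rep A g * sign_rep A g = 1\<^sub>m 1" for g
    by (rule eq_matI) (auto simp: sign_rep_def scalar_prod_def)
  have "sign_rep A g \<in> Units (ring_mat TYPE(complex) 1 ())" for g
    unfolding Units_def ring_mat_simps using sq[of g] by (auto simp: sign_rep_def)
  moreover have "sign_rep A (g \<otimes> h) = sign_rep A g * sign_rep A h"
    if "g \<in> carrier G" "h \<in> carrier G" for g h
    using A[OF that] by (intro eq_matI) (auto simp: sign_rep_def scalar_prod_def)
  ultimately have "matrix_rep G (sign_rep A)"
    by (simp add: matrix_rep_def dim hom_def units_of_def ring_mat_simps)
  then show ?thesis
    using subspace_module_vec_one by (auto simp: irreducible_rep_def dim)
qed

end

section \<open>Equivalence of irreducible representations\<close>

lemma equiv_rep_equiv: "equiv {\<sigma>. irreducible_rep G \<sigma>} (rep_equiv G)"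
proof (rule equivI)
  show "rep_equiv G \<subseteq> {\<sigma>. irreducible_rep G \<sigma>} \<times> {\<sigma>. irreducible_rep G \<sigma>}"
    by (auto simp: rep_equiv_def)
  show "refl_on {\<sigma>. irreducible_rep G \<sigma>} (rep_equiv G)"
  proof (rule refl_onI)
    fix \<sigma> assume "\<sigma> \<in> {\<sigma>. irreducible_rep G \<sigma>}"
    then have irr: "irreducible_rep G \<sigma>" by simp
    have "\<forall>g\<in>carrier G. similar_mat_wit (\<sigma> g) (\<sigma> g) (1\<^sub>m (rep_dim G \<sigma>)) (1\<^sub>m (rep_dim G \<sigma>))"
      using similar_mat_wit_refl[OF matrix_rep_carrier[OF irreducible_repD(1)[OF irr]]] by blast
    with irr show "(\<sigma>, \<sigma>) \<in> rep_equiv G"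
      unfolding rep_equiv_def by blast
  qed
  show "sym (rep_equiv G)"
    unfolding sym_def rep_equiv_def using similar_mat_wit_sym by blast
  show "trans (rep_equiv G)"
    unfolding trans_def rep_equiv_def using similar_mat_wit_trans by blast
qed

lemma rep_equivI:
  assumes "irreducible_rep G \<sigma>" "irreducible_rep G \<tau>" "\<And>g. g \<in> carrier G \<Longrightarrow> \<sigma> g = \<tau> g"
  shows "(\<sigma>, \<tau>) \<in> rep_equiv G"
proof -
  have "(\<sigma>, \<sigma>) \<in> rep_equiv G"
    using equiv_class_self[OF equiv_rep_equiv] assms(1) by blast
  then show ?thesis using assms by (simp add: rep_equiv_def)
qed

section \<open>The ordering parameter\<close>

locale symmetric_generating_set = group G for G (structure) +
  fixes S :: "'a set"
  assumes finite_carrier: "finite (carrier G)"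
    and generators_subset: "S \<subseteq> carrier G"
    and generators_nonempty: "S \<noteq> {}"
    and inv_generator: "s \<in> S \<Longrightarrow> inv s \<in> S"
    and generate_eq: "generate G S = carrier G"
begin

lemma finite_generators: "finite S"
  using finite_carrier generators_subset finite_subset by blast

text \<open>Symmetry of \<open>S\<close> absorbs the case of inverses of generators, which the
  induction rule of \<open>generate\<close> has in addition.\<close>

lemma generators_induct [consumes 1, case_names one generator mult]:
  assumes "g \<in> carrier G"
    and "P \<one>" "\<And>s. s \<in> S \<Longrightarrow> P s"
    and "\<And>g h. g \<in> carrier G \<Longrightarrow> h \<in> carrier G \<Longrightarrow> P g \<Longrightarrow> P h \<Longrightarrow> P (g \<otimes> h)"
  shows "P g"
proof -
  have "g \<in> generate G S" using assms(1) generate_eq by simp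
  then show ?thesis
  proof (induction g rule: generate.induct)
    case (eng h1 h2)
    then show ?case using assms(4) generate_eq by simp
  qed (use assms(2,3) inv_generator in auto)
qed

lemma matrix_rep_eqI:
  assumes \<sigma>: "matrix_rep G \<sigma>" and \<tau>: "matrix_rep G \<tau>" and dim: "rep_dim G \<sigma> = rep_dim G \<tau>"
    and eq: "\<And>s. s \<in> S \<Longrightarrow> \<sigma> s = \<tau> s" and g: "g \<in> carrier G"
  shows "\<sigma> g = \<tau> g"
  using g
proof (induction g rule: generators_induct)
  case one
  then show ?case using \<sigma> \<tau> dim by (simp add: matrix_rep_one)
qed (use \<sigma> \<tau> eq in \<open>auto simp: matrix_rep_mult\<close>)

text \<open>Products of scalar matrices are scalar, so the property spreads from the generators to
  the whole group.\<close>

lemma irreducible_rep_scalar_generators_imp_dim_one: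
  assumes irr: "irreducible_rep G \<sigma>"
    and scalar: "\<And>s. s \<in> S \<Longrightarrow> \<sigma> s = c \<cdot>\<^sub>m 1\<^sub>m (rep_dim G \<sigma>)"
  shows "rep_dim G \<sigma> = 1"
proof (rule irreducible_rep_scalar_imp_dim_one[OF irr])
  fix g assume "g \<in> carrier G"
  then show "\<exists>c. \<sigma> g = c \<cdot>\<^sub>m 1\<^sub>m (rep_dim G \<sigma>)"
  proof (induction g rule: generators_induct)
    case one
    then show ?case
      using matrix_rep_one[OF irreducible_repD(1)[OF irr]] by (intro exI[of _ 1]) auto
  next
    case (generator s)
    then show ?case using scalar by blast
  next
    case (mult g h)
    let ?I = "1\<^sub>m (rep_dim G \<sigma>) :: complex mat"
    obtain a b where ab: "\<sigma> g = a \<cdot>\<^sub>m ?I" "\<sigma> h = b \<cdot>\<^sub>m ?I" using mult by blast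
    have "\<sigma> (g \<otimes> h) = (a \<cdot>\<^sub>m ?I) * (b \<cdot>\<^sub>m ?I)"
      using matrix_rep_mult[OF irreducible_repD(1)[OF irr]] mult ab by simp
    also have "\<dots> = (a * b) \<cdot>\<^sub>m ?I"
      by (intro eq_matI) auto
    finally show ?case by blast
  qed
qed

section \<open>Bounds for the ordering parameter\<close>

lemma order_param_eq:
  assumes rep: "matrix_rep G \<sigma>"
  shows "order_param G S \<sigma> = 1 - (\<Sum>s\<in>S. mat_trace (\<sigma> s)) / of_nat (rep_dim G \<sigma> * card S)"
proof -
  have mat: "\<sigma> s \<in> carrier_mat (rep_dim G \<sigma>) (rep_dim G \<sigma>)" if "s \<in> S" for s
    using matrix_rep_carrier[OF rep] that generators_subset by blast
  show ?thesis
    using mat_trace_finsum[OF finite_generators mat]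
    by (simp add: order_param_def avg_mat_def mat_trace_smult[of _ "rep_dim G \<sigma>"])
qed

text \<open>The number \<open>1 - order_param G S \<sigma>\<close> is the average over
  \<open>S\<close> of the traces divided by the degree. After rotation by \<open>cnj c\<close> each
  term has real part at most one, so the average reaches one only if every term does.\<close>

lemma
  assumes irr: "irreducible_rep G \<sigma>" and c: "norm c = 1"
  shows Re_order_param_le: "Re (cnj c * (1 - order_param G S \<sigma>)) \<le> 1"
    and Re_order_param_eq_one_imp:
      "Re (cnj c * (1 - order_param G S \<sigma>)) = 1 \<Longrightarrow> s \<in> S \<Longrightarrow> \<sigma> s = c \<cdot>\<^sub>m 1\<^sub>m (rep_dim G \<sigma>)"
    and order_param_scalar:
      "(\<And>s. s \<in> S \<Longrightarrow> \<sigma> s = c \<cdot>\<^sub>m 1\<^sub>m (rep_dim G \<sigma>)) \<Longrightarrow> order_param G S \<sigma> = 1 - c"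
proof -
  define d where "d = rep_dim G \<sigma>"
  have rep: "matrix_rep G \<sigma>" and d: "d > 0"
    using irreducible_repD[OF irr] by (auto simp: d_def)
  have cardS: "card S > 0"
    using finite_generators generators_nonempty by (simp add: card_gt_0_iff)
  have ord: "Coset.order G > 0"
    using finite_carrier order_gt_0_iff_finite by simp
  have mat: "\<sigma> s \<in> carrier_mat d d" and pow: "\<sigma> s ^\<^sub>m Coset.order G = 1\<^sub>m d" if "s \<in> S" for s
    using matrix_rep_carrier[OF rep] matrix_rep_pow_order[OF rep] that generators_subset
    by (auto simp: d_def)
  \<comment> \<open>The denominator is cast from the reals so that \<open>Re\<close> can be moved
    past the division.\<close>
  have param: "1 - order_param G S \<sigma> = (\<Sum>s\<in>S. mat_trace (\<sigma> s)) / of_real (real (d * card S))"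
    using order_param_eq[OF rep] by (simp add: d_def)
  have Re: "Re (cnj c * (1 - order_param G S \<sigma>))
      = (\<Sum>s\<in>S. Re (cnj c * mat_trace (\<sigma> s))) / real (d * card S)"
    unfolding param times_divide_eq_right Re_divide_of_real sum_distrib_left Re_sum ..
  have le: "Re (cnj c * mat_trace (\<sigma> s)) \<le> d" if "s \<in> S" for s
    using finite_order_trace_le[OF mat pow ord c] that by blast
  have "(\<Sum>s\<in>S. Re (cnj c * mat_trace (\<sigma> s))) \<le> real (d * card S)"
    using sum_mono[of S "\<lambda>s. Re (cnj c * mat_trace (\<sigma> s))" "\<lambda>_. real d"] le
    by (simp add: mult.commute)
  then show "Re (cnj c * (1 - order_param G S \<sigma>)) \<le> 1"
    unfolding Re using d cardS by simp
  show "\<sigma> s = c \<cdot>\<^sub>m 1\<^sub>m (rep_dim G \<sigma>)"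
    if "Re (cnj c * (1 - order_param G S \<sigma>)) = 1" and s: "s \<in> S"
  proof -
    have "(\<Sum>s\<in>S. Re (cnj c * mat_trace (\<sigma> s))) = real (d * card S)"
      using that(1) d cardS unfolding Re by (simp add: field_simps)
    then have "(\<Sum>s\<in>S. d - Re (cnj c * mat_trace (\<sigma> s))) = 0"
      by (simp add: sum_subtractf)
    then have "d - Re (cnj c * mat_trace (\<sigma> s)) = 0"
      using le s finite_generators by (subst (asm) sum_nonneg_eq_0_iff) auto
    then show ?thesis
      using finite_order_trace_eq_imp_scalar[OF mat[OF s] pow[OF s] ord c] by (simp add: d_def)
  qed
  show "order_param G S \<sigma> = 1 - c"
    if "\<And>s. s \<in> S \<Longrightarrow> \<sigma> s = c \<cdot>\<^sub>m 1\<^sub>m (rep_dim G \<sigma>)"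
  proof -
    have "(\<Sum>s\<in>S. mat_trace (\<sigma> s)) = of_nat (card S) * (c * of_nat d)"
      using that by (simp add: mat_trace_smult[of _ d] mat_trace_one d_def)
    then show ?thesis
      using order_param_eq[OF rep] d cardS by (simp add: d_def)
  qed
qed

section \<open>Independence of the representative\<close>

lemma order_param_cong:
  assumes "(\<sigma>, \<tau>) \<in> rep_equiv G"
  shows "order_param G S \<sigma> = order_param G S \<tau>"
proof -
  obtain P Q where sim: "\<And>g. g \<in> carrier G \<Longrightarrow> similar_mat_wit (\<sigma> g) (\<tau> g) P Q"
    and irr: "irreducible_rep G \<sigma>" "irreducible_rep G \<tau>"
    using assms unfolding rep_equiv_def by blast
  have "rep_dim G \<sigma> = rep_dim G \<tau>"
    using similar_mat_witD(5)[OF refl sim[OF one_closed]] by (simp add: rep_dim_def)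
  moreover have "(\<Sum>s\<in>S. mat_trace (\<sigma> s)) = (\<Sum>s\<in>S. mat_trace (\<tau> s))"
    using sim generators_subset by (intro sum.cong refl mat_trace_similar) blast
  ultimately show ?thesis
    using irr by (simp add: order_param_eq irreducible_repD)
qed

text \<open>The parameter is constant on the class and the class contains \<open>\<sigma>\<close>,
  so its image is a singleton and \<open>the_elem\<close> is meaningful.\<close>

lemma class_order_param_class:
  assumes "irreducible_rep G \<sigma>"
  shows "class_order_param G S (rep_equiv G `` {\<sigma>}) = Re (order_param G S \<sigma>)"
proof -
  have "(\<sigma>, \<sigma>) \<in> rep_equiv G"
    using assms by (simp add: rep_equivI)
  then have "order_param G S ` (rep_equiv G `` {\<sigma>}) = {order_param G S \<sigma>}"
    by (auto dest: order_param_cong intro: rev_image_eqI)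
  then show ?thesis by (simp add: class_order_param_def)
qed

lemma trivial_rep_irreducible: "irreducible_rep G trivial_rep"
proof -
  \<comment> \<open>With everything in the positive part all signs are \<open>1\<close>.\<close>
  have "trivial_rep = sign_rep (UNIV :: 'a set)"
    by (rule ext) (auto simp: trivial_rep_def sign_rep_def)
  then show ?thesis using sign_rep_irreducible[of UNIV] by simp
qed

text \<open>This is the equality case for \<open>c = 1\<close>: the representation is the identity
  on \<open>S\<close>, hence of degree one and equal to the trivial one on the carrier.\<close>

lemma order_param_eq_0_iff:
  assumes irr: "irreducible_rep G \<sigma>"
  shows "order_param G S \<sigma> = 0 \<longleftrightarrow> (\<sigma>, trivial_rep) \<in> rep_equiv G"
proof
  assume "order_param G S \<sigma> = 0"
  then have one: "\<sigma> s = 1 \<cdot>\<^sub>m 1\<^sub>m (rep_dim G \<sigma>)" if "s \<in> S" for s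
    using Re_order_param_eq_one_imp[OF irr, of 1] that by simp
  then have dim: "rep_dim G \<sigma> = 1"
    by (rule irreducible_rep_scalar_generators_imp_dim_one[OF irr])
  have "\<sigma> g = trivial_rep g" if "g \<in> carrier G" for g
  proof (rule matrix_rep_eqI[OF _ _ _ _ that])
    show "rep_dim G \<sigma> = rep_dim G trivial_rep"
      unfolding dim by (simp add: rep_dim_def trivial_rep_def)
    show "\<sigma> s = trivial_rep s" if "s \<in> S" for s
      using one[OF that] unfolding dim trivial_rep_def by auto
  qed (use irr trivial_rep_irreducible irreducible_repD in auto)
  then show "(\<sigma>, trivial_rep) \<in> rep_equiv G"
    by (rule rep_equivI[OF irr trivial_rep_irreducible])
next
  assume "(\<sigma>, trivial_rep) \<in> rep_equiv G"
  then have "order_param G S \<sigma> = order_param G S trivial_rep"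
    by (rule order_param_cong)
  also have "\<dots> = 1 - 1"
    by (rule order_param_scalar[OF trivial_rep_irreducible])
      (auto simp: trivial_rep_def rep_dim_def)
  finally show "order_param G S \<sigma> = 0" by simp
qed

text \<open>Since the degree is at most \<open>|G|\<close>, every character value is a
  sum of at most \<open>|G|\<close> roots of unity of order \<open>|G|\<close>.\<close>

lemma finite_class_order_param: "finite (class_order_param G S ` irr_classes G)"
proof -
  define N where "N = Coset.order G"
  define T :: "complex set"
    where "T = sum_list ` {es. set es \<subseteq> {z. z ^ N = 1} \<and> length es \<le> N}"
  \<comment> \<open>\<open>F\<close> recovers the parameter from the degree and the traces on
    \<open>S\<close>, so all parameters lie in the image of a finite set of pairs.\<close>
  define F where "F = (\<lambda>(d, f). Re (1 - (\<Sum>s\<in>S. f s :: complex) / of_nat (d * card S)))"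
  have N: "N > 0"
    using finite_carrier order_gt_0_iff_finite by (simp add: N_def)
  then have "finite T"
    unfolding T_def
    by (intro finite_imageI finite_lists_length_le finite_roots_unity) auto
  then have "finite (F ` ({..N} \<times> (S \<rightarrow>\<^sub>E T)))"
    using finite_generators by (intro finite_imageI finite_cartesian_product finite_PiE) auto
  moreover have "class_order_param G S ` irr_classes G \<subseteq> F ` ({..N} \<times> (S \<rightarrow>\<^sub>E T))"
  proof
    fix x assume "x \<in> class_order_param G S ` irr_classes G"
    then obtain \<sigma> where irr: "irreducible_rep G \<sigma>"
      and x: "x = class_order_param G S (rep_equiv G `` {\<sigma>})"
      unfolding irr_classes_def by (auto elim!: quotientE)
    note rep = irreducible_repD(1)[OF irr]
    have dim: "rep_dim G \<sigma> \<le> N"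
      using irreducible_rep_dim_le_order[OF irr finite_carrier] by (simp add: N_def)
    have "mat_trace (\<sigma> s) \<in> T" if "s \<in> S" for s
    proof -
      have s: "s \<in> carrier G" using that generators_subset by blast
      show ?thesis
        using finite_order_trace_in_sum_list_roots[OF matrix_rep_carrier[OF rep s]
            matrix_rep_pow_order[OF rep s]] dim
        unfolding T_def N_def by auto
    qed
    \<comment> \<open>Restriction to \<open>S\<close> puts the trace function into the extensional
      function space, which is finite.\<close>
    then have "restrict (\<lambda>s. mat_trace (\<sigma> s)) S \<in> S \<rightarrow>\<^sub>E T" by auto
    moreover have "x = F (rep_dim G \<sigma>, restrict (\<lambda>s. mat_trace (\<sigma> s)) S)"
      unfolding x class_order_param_class[OF irr] order_param_eq[OF rep] F_def by simp
    ultimately show "x \<in> F ` ({..N} \<times> (S \<rightarrow>\<^sub>E T))" using dim by blast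
  qed
  ultimately show ?thesis by (rule finite_subset[rotated])
qed

text \<open>For \<open>c = -1\<close> the bounded quantity is
  \<open>Re (order_param G S \<sigma>) - 1\<close>.\<close>

lemma Re_order_param_le_2:
  assumes "irreducible_rep G \<sigma>"
  shows "Re (order_param G S \<sigma>) \<le> 2"
  using Re_order_param_le[OF assms, of "-1"] by simp

lemma Re_order_param_eq_2_imp:
  assumes "irreducible_rep G \<sigma>" "Re (order_param G S \<sigma>) = 2" "s \<in> S"
  shows "\<sigma> s = (-1) \<cdot>\<^sub>m 1\<^sub>m (rep_dim G \<sigma>)"
  using Re_order_param_eq_one_imp[OF assms(1), of "-1" s] assms by simp

section \<open>Bipartite Cayley graphs\<close>

text \<open>Right multiplication by a generator follows an edge and so changes the part.\<close>

lemma bipartition_generator_notin: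
  assumes "bipartition (cayley_graph G S) A B" "g \<in> carrier G" "s \<in> S"
  shows "g \<otimes> s \<in> A \<longleftrightarrow> g \<notin> A"
  using assms unfolding bipartition_def cayley_graph_def by fastforce

text \<open>This is multiplicativity of the sign. The induction runs over the right factor with
  \<open>g\<close> arbitrary, since edges come from right multiplication.\<close>

lemma bipartition_mult_iff:
  assumes bip: "bipartition (cayley_graph G S) A B" and one: "\<one> \<in> A"
    and "g \<in> carrier G" "h \<in> carrier G"
  shows "g \<otimes> h \<in> A \<longleftrightarrow> (g \<in> A \<longleftrightarrow> h \<in> A)"
  using assms(4,3)
proof (induction h arbitrary: g rule: generators_induct)
  case one
  then show ?case using \<open>\<one> \<in> A\<close> by simp
next
  case (generator s)
  then have "s \<in> carrier G" using generators_subset by blast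
  then have "s \<notin> A"
    using bipartition_generator_notin[OF bip one_closed generator(1)] one by simp
  then show ?case using bipartition_generator_notin[OF bip generator(2,1)] by simp
next
  case (mult h k)
  \<comment> \<open>After reassociation the hypothesis for \<open>k\<close> is used at both
    \<open>g \<otimes> h\<close> and \<open>h\<close>.\<close>
  then show ?case by (auto simp flip: m_assoc)
qed

text \<open>A generator is adjacent to the identity, so it lies in the other part and has sign
  \<open>-1\<close>; the parameter is then \<open>1 - (-1)\<close>.\<close>

lemma
  assumes bip: "bipartition (cayley_graph G S) A B" and one: "\<one> \<in> A"
  shows sign_rep_bipartition_irreducible: "irreducible_rep G (sign_rep A)"
    and sign_rep_generator: "s \<in> S \<Longrightarrow> sign_rep A s = (-1) \<cdot>\<^sub>m 1\<^sub>m 1"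
    and order_param_sign_rep: "order_param G S (sign_rep A) = 2"
proof -
  show irr: "irreducible_rep G (sign_rep A)"
    by (rule sign_rep_irreducible[OF bipartition_mult_iff[OF bip one]])
  show gen: "sign_rep A s = (-1) \<cdot>\<^sub>m 1\<^sub>m 1" if "s \<in> S" for s
    using bipartition_generator_notin[OF bip one_closed that] one that generators_subset
    by (auto simp: sign_rep_def)
  have "order_param G S (sign_rep A) = 1 - (-1)"
    using gen by (intro order_param_scalar[OF irr]) (auto simp: rep_dim_def sign_rep_def)
  then show "order_param G S (sign_rep A) = 2" by simp
qed

text \<open>Both representations have degree one and the value \<open>-1\<close> on
  \<open>S\<close>, which determines them on the carrier. This yields uniqueness of the
  maximizer.\<close>

lemma Re_order_param_eq_2_imp_sign_rep:
  assumes bip: "bipartition (cayley_graph G S) A B" and one: "\<one> \<in> A"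
    and irr: "irreducible_rep G \<sigma>" and eq2: "Re (order_param G S \<sigma>) = 2"
  shows "(\<sigma>, sign_rep A) \<in> rep_equiv G"
proof (rule rep_equivI[OF irr sign_rep_bipartition_irreducible[OF bip one]])
  note gen = Re_order_param_eq_2_imp[OF irr eq2]
  have dim: "rep_dim G \<sigma> = 1"
    by (rule irreducible_rep_scalar_generators_imp_dim_one[OF irr gen])
  fix g assume "g \<in> carrier G"
  then show "\<sigma> g = sign_rep A g"
  proof (rule matrix_rep_eqI[rotated -1])
    show "rep_dim G \<sigma> = rep_dim G (sign_rep A)"
      unfolding dim by (simp add: rep_dim_def sign_rep_def)
    show "\<sigma> s = sign_rep A s" if "s \<in> S" for s
      using gen[OF that] sign_rep_generator[OF bip one that] dim by simp
  qed (use irr sign_rep_bipartition_irreducible[OF bip one] irreducible_repD in auto)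
qed

lemma bipartition_swap:
  assumes "bipartition H A B"
  shows "bipartition H B A"
  using assms unfolding bipartition_def by fast

lemma bipartite_imp_bipartition_one:
  assumes "bipartite (cayley_graph G S)"
  obtains A B where "bipartition (cayley_graph G S) A B" "\<one> \<in> A"
proof -
  obtain A B where AB: "bipartition (cayley_graph G S) A B"
    using assms unfolding bipartite_def by blast
  then have "\<one> \<in> A \<or> \<one> \<in> B"
    using one_closed unfolding bipartition_def cayley_graph_def by auto
  then show ?thesis using AB bipartition_swap that by blast
qed

text \<open>Generators act as minus the identity, so every value is plus or minus the identity
  matrix. The two signs give the parts, and each edge flips the sign.\<close>

lemma Re_order_param_eq_2_imp_bipartite:
  assumes irr: "irreducible_rep G \<sigma>" and eq2: "Re (order_param G S \<sigma>) = 2"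
  shows "bipartite (cayley_graph G S)"
proof -
  define d where "d = rep_dim G \<sigma>"
  let ?I = "1\<^sub>m d :: complex mat"
  note rep = irreducible_repD(1)[OF irr]
  have d: "d > 0" using irreducible_repD(2)[OF irr] by (simp add: d_def)
  note gen = Re_order_param_eq_2_imp[OF irr eq2, folded d_def]
  define A where "A = {g \<in> carrier G. \<sigma> g = ?I}"
  define B where "B = {g \<in> carrier G. \<sigma> g = (-1) \<cdot>\<^sub>m ?I}"
  have neg: "((-1) \<cdot>\<^sub>m ?I) * ((-1) \<cdot>\<^sub>m ?I) = ?I"
    by (intro eq_matI) auto
  \<comment> \<open>Positive degree keeps the two matrices apart, which makes the parts
    disjoint.\<close>
  have ne: "?I \<noteq> (-1) \<cdot>\<^sub>m ?I"
  proof
    assume "?I = (-1) \<cdot>\<^sub>m ?I"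
    then have "?I $$ (0, 0) = ((-1) \<cdot>\<^sub>m ?I) $$ (0, 0)" by simp
    then show False using d by simp
  qed
  have AB: "g \<in> A \<union> B" if "g \<in> carrier G" for g
    using that
  proof (induction g rule: generators_induct)
    case one
    then show ?case using matrix_rep_one[OF rep] by (simp add: A_def d_def)
  next
    case (generator s)
    then show ?case using gen generators_subset by (auto simp: B_def)
  next
    case (mult g h)
    then show ?case using neg by (auto simp: A_def B_def matrix_rep_mult[OF rep])
  qed
  have "bipartition (cayley_graph G S) A B"
    unfolding bipartition_def
  proof (intro conjI ballI)
    show "A \<union> B = pverts (cayley_graph G S)"
      using AB by (auto simp: A_def B_def cayley_graph_def)
    show "A \<inter> B = {}" using ne by (auto simp: A_def B_def)
    fix e assume "e \<in> parcs (cayley_graph G S)"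
    then obtain g s where e: "e = (g, g \<otimes> s)" and g: "g \<in> carrier G" and s: "s \<in> S"
      by (auto simp: cayley_graph_def)
    have sG: "s \<in> carrier G" using s generators_subset by blast
    have "\<sigma> (g \<otimes> s) = \<sigma> g * ((-1) \<cdot>\<^sub>m ?I)"
      using matrix_rep_mult[OF rep g sG] gen[OF s] by simp
    then have "g \<in> A \<and> g \<otimes> s \<in> B \<or> g \<in> B \<and> g \<otimes> s \<in> A"
      using AB[OF g] g sG neg by (auto simp: A_def B_def)
    then show "case e of (u, v) \<Rightarrow> u \<in> A \<and> v \<in> B \<or> u \<in> B \<and> v \<in> A"
      by (simp add: e)
  qed
  then show ?thesis unfolding bipartite_def by blast
qed

section \<open>The maximum over the irreducible classes\<close>

lemma irr_classesE:
  assumes "C \<in> irr_classes G"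
  obtains \<sigma> where "irreducible_rep G \<sigma>" "C = rep_equiv G `` {\<sigma>}"
    "class_order_param G S C = Re (order_param G S \<sigma>)"
  using assms class_order_param_class unfolding irr_classes_def by (auto elim!: quotientE)

lemma class_in_irr_classes: "irreducible_rep G \<sigma> \<Longrightarrow> rep_equiv G `` {\<sigma>} \<in> irr_classes G"
  unfolding irr_classes_def by (simp add: quotientI)

text \<open>The set of parameters is finite, and nonempty by the trivial class, so its maximum is
  attained by some representation. Conversely, the sign class reaches the upper bound 2.\<close>

lemma Max_class_order_param_eq_2_iff:
  "Max (class_order_param G S ` irr_classes G) = 2 \<longleftrightarrow> bipartite (cayley_graph G S)"
proof
  assume "Max (class_order_param G S ` irr_classes G) = 2"
  moreover have "class_order_param G S ` irr_classes G \<noteq> {}"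
    using class_in_irr_classes[OF trivial_rep_irreducible] by blast
  ultimately have "2 \<in> class_order_param G S ` irr_classes G"
    using Max_in[OF finite_class_order_param] by metis
  then obtain C where "C \<in> irr_classes G" "class_order_param G S C = 2" by auto
  then obtain \<sigma> where "irreducible_rep G \<sigma>" "Re (order_param G S \<sigma>) = 2"
    by (metis irr_classesE)
  then show "bipartite (cayley_graph G S)" by (rule Re_order_param_eq_2_imp_bipartite)
next
  assume "bipartite (cayley_graph G S)"
  then obtain A B where bip: "bipartition (cayley_graph G S) A B" and one: "\<one> \<in> A"
    by (rule bipartite_imp_bipartition_one)
  note irr = sign_rep_bipartition_irreducible[OF bip one]
  show "Max (class_order_param G S ` irr_classes G) = 2"
  proof (rule Max_eqI[OF finite_class_order_param])
    show "x \<le> 2" if "x \<in> class_order_param G S ` irr_classes G" for x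
      using that Re_order_param_le_2 by (auto elim!: irr_classesE)
    have "class_order_param G S (rep_equiv G `` {sign_rep A}) = 2"
      using class_order_param_class[OF irr] order_param_sign_rep[OF bip one] by simp
    then show "2 \<in> class_order_param G S ` irr_classes G"
      using class_in_irr_classes[OF irr] by (metis image_eqI)
  qed
qed

text \<open>As the sign class attains the bound 2, any maximizer also has parameter 2 and hence is
  the class of the sign representation.\<close>

lemma arg_max_class_order_param:
  assumes bip: "bipartition (cayley_graph G S) A B" and one: "\<one> \<in> A"
  shows "{C. is_arg_max (class_order_param G S) (\<lambda>C. C \<in> irr_classes G) C} =
    {rep_equiv G `` {sign_rep A}}"
proof -
  let ?C = "rep_equiv G `` {sign_rep A}"
  note irr = sign_rep_bipartition_irreducible[OF bip one]
  have C: "?C \<in> irr_classes G" "class_order_param G S ?C = 2"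
    using class_in_irr_classes[OF irr] class_order_param_class[OF irr]
      order_param_sign_rep[OF bip one] by auto
  have le: "class_order_param G S D \<le> 2" if "D \<in> irr_classes G" for D
    using that Re_order_param_le_2 by (auto elim!: irr_classesE)
  have "D = ?C" if D: "D \<in> irr_classes G" "class_order_param G S D = 2" for D
  proof -
    obtain \<sigma> where \<sigma>: "irreducible_rep G \<sigma>" "D = rep_equiv G `` {\<sigma>}" "Re (order_param G S \<sigma>) = 2"
      using D by (metis irr_classesE)
    then show ?thesis
      using equiv_class_eq[OF equiv_rep_equiv Re_order_param_eq_2_imp_sign_rep[OF bip one]] by simp
  qed
  then have "is_arg_max (class_order_param G S) (\<lambda>C. C \<in> irr_classes G) D \<longleftrightarrow> D = ?C" for D
    using C le unfolding is_arg_max_linorder by (metis order_antisym)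
  then show ?thesis by blast
qed

end

theorem proposition3:
  fixes G :: "('g, 'm) monoid_scheme" (structure)
    and S :: "'g set"
  assumes "group G" and "finite (carrier G)"
    and "S \<subseteq> carrier G" and "S \<noteq> {}"
    and "\<forall>s\<in>S. inv s \<in> S"
    and "generate G S = carrier G"
  shows "(\<forall>\<sigma>. irreducible_rep G \<sigma> \<longrightarrow>
            (order_param G S \<sigma> = 0 \<longleftrightarrow> (\<sigma>, trivial_rep) \<in> rep_equiv G)) \<and>
         (Max (class_order_param G S ` irr_classes G) = 2 \<longleftrightarrow> bipartite (cayley_graph G S)) \<and>
         (\<forall>A B. bipartition (cayley_graph G S) A B \<and> \<one> \<in> A \<longrightarrow>
            {C. is_arg_max (class_order_param G S) (\<lambda>C. C \<in> irr_classes G) C} =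
            {rep_equiv G `` {sign_rep A}})"
proof -
  interpret group G by fact
  interpret symmetric_generating_set G S
    using assms by unfold_locales auto
  show ?thesis
    using order_param_eq_0_iff Max_class_order_param_eq_2_iff arg_max_class_order_param by blast
qed

end
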